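(* For each positive integer $n$, let $$F=F(X,Y)=\sum_{0\le i,j\le n}\varepsilon_{i,j}X^iY^j$$ be a random bivariate polynomial whose $(n+1)^2$ coefficients $\varepsilon_{i,j}$ are chosen independently and uniformly at random from $\{0,1,-1\}$. Then $$\lim_{n\to\infty}\mathbb{P}(F\ \text{is reducible})=0.$$
   Context: Reducible means reducible over $\mathbb{Z}[X,Y]$, i.e. $F=GH$ for some non-constant $G,H\in\mathbb{Z}[X,Y]$. Equivalently, the probability is the number of reducible polynomials among the $3^{(n+1)^2}$ polynomials $\sum_{0\le i,j\le n}\varepsilon_{i,j}X^iY^j$ with all $\varepsilon_{i,j}\in\{0,1,-1\}$, divided by $3^{(n+1)^2}$. *)

theory Defs
  imports
    "HOL-Probability.Probability"
    "HOL-Computational_Algebra.Polynomial"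
begin

text \<open>\<open>\<int>[X,Y]\<close> is represented as \<^typ>\<open>int poly poly\<close>: the inner indeterminate is \<open>X\<close>, the outer one
  is \<open>Y\<close>, so \<open>c X\<^sup>i Y\<^sup>j\<close> is \<^term>\<open>monom (monom c i) j\<close>.\<close>

definition bivar_poly :: "nat \<Rightarrow> (nat \<times> nat \<Rightarrow> int) \<Rightarrow> int poly poly" where
  "bivar_poly n \<epsilon> = (\<Sum>i\<le>n. \<Sum>j\<le>n. monom (monom (\<epsilon> (i, j)) i) j)"

definition constant_poly :: "int poly poly \<Rightarrow> bool" where
  "constant_poly F \<longleftrightarrow> (\<exists>c. F = [:[:c:]:])"

text \<open>Both factors have to be non-constant as polynomials in \<open>X\<close> and \<open>Y\<close>; an integer factor such as
  \<open>2\<close> does not count. This differs from the negation of \<^const>\<open>irreducible\<close>.\<close>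

definition reducible_poly :: "int poly poly \<Rightarrow> bool" where
  "reducible_poly F \<longleftrightarrow> (\<exists>G H. \<not> constant_poly G \<and> \<not> constant_poly H \<and> F = G * H)"

text \<open>The product measure \<^const>\<open>Pi_pmf\<close> makes the coefficients independent; its second argument
  \<open>0\<close> is merely the default value outside the index set.\<close>

definition random_coeffs :: "nat \<Rightarrow> (nat \<times> nat \<Rightarrow> int) pmf" where
  "random_coeffs n = Pi_pmf ({..n} \<times> {..n}) 0 (\<lambda>_. pmf_of_set {0, 1, -1})"

definition random_poly :: "nat \<Rightarrow> int poly poly pmf" where
  "random_poly n = map_pmf (bivar_poly n) (random_coeffs n)"

end

theory Submission
  imports Defs "HOL-Real_Asymp.Real_Asymp"
begin

text \<open>The coefficients \<open>0, 1, -1\<close> represent the residues modulo 3, so \<open>F\<close> is determined by its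
  reduction modulo 3, hence by the reductions of the factors \<open>G\<close> and \<open>H\<close>. If \<open>G\<close> has bidegree
  \<open>(a, b)\<close>, then \<open>H\<close> has bidegree at most \<open>(n - a, n - b)\<close>, so there are at most
  \<open>3\<close> to the power \<open>(a + 1)(b + 1) + (n - a + 1)(n - b + 1)\<close> such \<open>F\<close>. This exponent falls short of
  \<open>(n + 1)\<^sup>2\<close> by \<open>a (n - b) + (n - a) b - 1 \<ge> n - 1\<close>, because \<open>(a, b)\<close> is neither \<open>(0, 0)\<close> nor
  \<open>(n, n)\<close>. Summing over the \<open>(n + 1)\<^sup>2\<close> pairs \<open>(a, b)\<close> bounds the probability by
  \<open>(n + 1)\<^sup>2 3\<^bsup>1-n\<^esup>\<close>.\<close>

section \<open>Polynomials with coefficients supported in a box\<close>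

definition box_poly :: "nat \<Rightarrow> nat \<Rightarrow> (nat \<times> nat \<Rightarrow> int) \<Rightarrow> int poly poly" where
  "box_poly a b g = (\<Sum>i\<le>a. \<Sum>j\<le>b. monom (monom (g (i, j)) i) j)"

text \<open>Forcing the value 0 off the box keeps the set finite and makes it match the sample space
  of \<open>random_coeffs\<close>, whose default is also 0.\<close>

definition box_coeffs :: "nat \<Rightarrow> nat \<Rightarrow> (nat \<times> nat \<Rightarrow> int) set" where
  "box_coeffs a b = PiE_dflt ({..a} \<times> {..b}) 0 (\<lambda>_. {0, 1, -1})"

lemma bivar_poly_eq_box_poly: "bivar_poly n = box_poly n n"
  by (simp add: bivar_poly_def box_poly_def fun_eq_iff)

lemma coeff_box_poly:
  "coeff (coeff (box_poly a b g) j) i = (if i \<le> a \<and> j \<le> b then g (i, j) else 0)"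
proof -
  have "coeff (coeff (box_poly a b g) j) i
      = (\<Sum>k\<le>a. \<Sum>l\<le>b. if l = j then if k = i then g (k, l) else 0 else 0)"
    unfolding box_poly_def coeff_sum
    by (intro sum.cong refl) auto
  then show ?thesis
    by (cases "j \<le> b") (simp_all add: sum.delta)
qed

lemma finite_box_coeffs: "finite (box_coeffs a b)"
  unfolding box_coeffs_def by (intro finite_PiE_dflt) auto

lemma card_box_coeffs: "card (box_coeffs a b) = 3 ^ ((a + 1) * (b + 1))"
  unfolding box_coeffs_def by (subst card_PiE_dflt) (simp_all add: card_cartesian_product numeral_3_eq_3 del: power_Suc)

section \<open>Balanced residues and reduction modulo 3\<close>

definition rep3 :: "int \<Rightarrow> int" where
  "rep3 x = (x + 1) mod 3 - 1"

lemma rep3_range: "rep3 x \<in> {0, 1, -1}"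
proof -
  have "(x + 1) mod 3 = 0 \<or> (x + 1) mod 3 = 1 \<or> (x + 1) mod 3 = 2"
    by presburger
  then show ?thesis by (auto simp: rep3_def)
qed

lemma rep3_cong: "3 dvd x - rep3 x"
  unfolding rep3_def by presburger

lemma rep3_unique: "y \<in> {0, 1, -1} \<Longrightarrow> 3 dvd x - y \<Longrightarrow> rep3 x = y"
  unfolding rep3_def by (auto; presburger)

text \<open>With this, congruence modulo 3 in the ring of integer polynomials can be tested
  coefficientwise, without passing to polynomials over the field with three elements.\<close>

lemma const_dvd_iff_coeff:
  fixes P :: "int poly poly"
  shows "[:[:c:]:] dvd P \<longleftrightarrow> (\<forall>i j. c dvd coeff (coeff P j) i)"
  by (auto simp: const_poly_dvd_iff)

lemma ex_box_coeffs_cong: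
  assumes "\<And>j. degree (coeff G j) \<le> a" and "degree G \<le> b"
  shows "\<exists>g \<in> box_coeffs a b. [:[:3:]:] dvd G - box_poly a b g"
proof -
  define g where "g = (\<lambda>(i, j). if i \<le> a \<and> j \<le> b then rep3 (coeff (coeff G j) i) else 0)"
  have "g \<in> box_coeffs a b"
    using rep3_range by (auto simp: g_def box_coeffs_def PiE_dflt_def)
  moreover have "[:[:3:]:] dvd G - box_poly a b g"
    unfolding const_dvd_iff_coeff
  proof (intro allI)
    fix i j
    \<comment> \<open>Off the box the coefficients of \<open>G\<close> vanish, in agreement with the
      default 0 of \<open>g\<close>.\<close>
    have "coeff (coeff G j) i = 0" if "\<not> (i \<le> a \<and> j \<le> b)"
    proof (cases "j \<le> b")
      case True
      then show ?thesis using that assms(1)[of j] by (intro coeff_eq_0) auto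
    next
      case False
      then have "coeff G j = 0" using assms(2) by (intro coeff_eq_0) auto
      then show ?thesis by simp
    qed
    then show "3 dvd coeff (coeff (G - box_poly a b g) j) i"
      using rep3_cong by (auto simp: coeff_box_poly g_def)
  qed
  ultimately show ?thesis by blast
qed

lemma dvd_mult_diff_mult:
  fixes x y x' y' d :: "'a :: comm_ring_1"
  assumes "d dvd x - x'" and "d dvd y - y'"
  shows "d dvd x * y - x' * y'"
proof -
  have "x * y - x' * y' = (x - x') * y + x' * (y - y')"
    by (simp add: algebra_simps)
  then show ?thesis using assms by (metis dvd_add dvd_mult dvd_mult2)
qed

section \<open>Counting products of factors from complementary boxes\<close>

text \<open>The degree conditions are only upper bounds, so these sets may overlap for different
  \<open>(a, b)\<close>; a union bound tolerates that.\<close>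

definition box_factorable :: "nat \<Rightarrow> nat \<Rightarrow> nat \<Rightarrow> (nat \<times> nat \<Rightarrow> int) set" where
  "box_factorable n a b = {\<epsilon> \<in> box_coeffs n n. \<exists>G H. bivar_poly n \<epsilon> = G * H \<and>
     (\<forall>j. degree (coeff G j) \<le> a) \<and> degree G \<le> b \<and>
     (\<forall>j. degree (coeff H j) \<le> n - a) \<and> degree H \<le> n - b}"

lemma card_box_factorable:
  "card (box_factorable n a b) \<le> 3 ^ ((a + 1) * (b + 1) + (n - a + 1) * (n - b + 1))"
proof -
  \<comment> \<open>A decoder: it multiplies the representatives of the two factors and reduces the
    coefficients modulo 3. The value 0 off the box is what makes
    \<open>\<epsilon> = \<Phi> (g, h)\<close> hold as an equality of functions.\<close>
  define \<Phi> where "\<Phi> = (\<lambda>(g, h) (i, j). if i \<le> n \<and> j \<le> n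
    then rep3 (coeff (coeff (box_poly a b g * box_poly (n - a) (n - b) h) j) i) else 0)"
  let ?P = "box_coeffs a b \<times> box_coeffs (n - a) (n - b)"
  have "box_factorable n a b \<subseteq> \<Phi> ` ?P"
  proof
    fix \<epsilon> assume "\<epsilon> \<in> box_factorable n a b"
    then obtain G H where \<epsilon>: "\<epsilon> \<in> box_coeffs n n" and F: "bivar_poly n \<epsilon> = G * H"
      and G: "\<And>j. degree (coeff G j) \<le> a" "degree G \<le> b"
      and H: "\<And>j. degree (coeff H j) \<le> n - a" "degree H \<le> n - b"
      unfolding box_factorable_def by blast
    obtain g where g: "g \<in> box_coeffs a b" "[:[:3:]:] dvd G - box_poly a b g"
      using ex_box_coeffs_cong[OF G] by blast
    obtain h where h: "h \<in> box_coeffs (n - a) (n - b)"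
        "[:[:3:]:] dvd H - box_poly (n - a) (n - b) h"
      using ex_box_coeffs_cong[OF H] by blast
    let ?Q = "box_poly a b g * box_poly (n - a) (n - b) h"
    have "[:[:3:]:] dvd ?Q - bivar_poly n \<epsilon>"
      using dvd_mult_diff_mult[OF g(2) h(2)] F by (metis dvd_minus_iff minus_diff_eq)
    then have cong: "3 dvd coeff (coeff ?Q j) i - coeff (coeff (bivar_poly n \<epsilon>) j) i" for i j
      by (simp add: const_dvd_iff_coeff)
    have "\<epsilon> = \<Phi> (g, h)"
    proof
      fix x :: "nat \<times> nat"
      obtain i j where x: "x = (i, j)" by (cases x)
      show "\<epsilon> x = \<Phi> (g, h) x"
      proof (cases "i \<le> n \<and> j \<le> n")
        case True
        then have "\<epsilon> x \<in> {0, 1, -1}" "3 dvd coeff (coeff ?Q j) i - \<epsilon> x"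
          using \<epsilon> cong[of j i] unfolding x box_coeffs_def PiE_dflt_def
          by (auto simp: bivar_poly_eq_box_poly coeff_box_poly)
        then have "rep3 (coeff (coeff ?Q j) i) = \<epsilon> x"
          by (rule rep3_unique)
        then show ?thesis using True by (simp add: \<Phi>_def x)
      next
        case False
        then show ?thesis using \<epsilon> by (auto simp: \<Phi>_def x box_coeffs_def PiE_dflt_def)
      qed
    qed
    then show "\<epsilon> \<in> \<Phi> ` ?P" using g(1) h(1) by blast
  qed
  then have "card (box_factorable n a b) \<le> card ?P"
    by (intro surj_card_le) (auto simp: finite_box_coeffs)
  also have "\<dots> = 3 ^ ((a + 1) * (b + 1) + (n - a + 1) * (n - b + 1))"
    by (simp only: card_cartesian_product card_box_coeffs power_add)
  finally show ?thesis .
qed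

section \<open>The degree in the inner variable X\<close>

lemma ex_inner_degree:
  fixes G :: "'a :: zero poly poly"
  assumes "G \<noteq> 0"
  obtains a j where "\<And>j. degree (coeff G j) \<le> a" and "coeff (coeff G j) a \<noteq> 0"
proof -
  let ?D = "\<lambda>j. degree (coeff G j)"
  \<comment> \<open>Vanishing coefficients have degree 0 too; excluding them ensures that the
    maximum is attained where the leading coefficient is nonzero.\<close>
  let ?S = "{j. coeff G j \<noteq> 0}"
  have "?S \<subseteq> {..degree G}"
    by (auto intro: le_degree)
  then have fin: "finite ?S"
    by (rule finite_subset) simp
  have ne: "?S \<noteq> {}"
    using assms by (auto simp: poly_eq_iff)
  have "Max (?D ` ?S) \<in> ?D ` ?S"
    using fin ne by (intro Max_in) auto
  then obtain k where k: "coeff G k \<noteq> 0" "?D k = Max (?D ` ?S)"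
    by auto
  have "?D j \<le> ?D k" for j
    using fin unfolding k(2) by (cases "coeff G j = 0") (auto intro!: Max_ge)
  moreover have "coeff (coeff G k) (?D k) \<noteq> 0"
    using k(1) by simp
  ultimately show ?thesis by (rule that)
qed

text \<open>The bounds need not be attained: if one of them is strict, both sides are 0.\<close>

lemma coeff_mult_degree_le:
  fixes p q :: "'a :: comm_semiring_0 poly"
  assumes "degree p \<le> a" and "degree q \<le> c"
  shows "coeff (p * q) (a + c) = coeff p a * coeff q c"
proof (cases "degree p = a \<and> degree q = c")
  case True
  then show ?thesis using coeff_mult_degree_sum[of p q] by auto
next
  case False
  then have "degree p + degree q < a + c" using assms by linarith
  then have "coeff (p * q) (a + c) = 0"
    using degree_mult_le[of p q] by (intro coeff_eq_0) linarith
  moreover have "coeff p a = 0 \<or> coeff q c = 0"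
    using False assms by (metis coeff_eq_0 le_neq_implies_less)
  ultimately show ?thesis by auto
qed

text \<open>When \<open>a\<close> and \<open>c\<close> are the X-degrees, the mapped polynomials are
  the leading coefficients with respect to X, viewed as polynomials in Y.\<close>

lemma map_poly_coeff_mult:
  fixes G H :: "'a :: comm_semiring_0 poly poly"
  assumes "\<And>j. degree (coeff G j) \<le> a" and "\<And>j. degree (coeff H j) \<le> c"
  shows "map_poly (\<lambda>p. coeff p (a + c)) (G * H)
    = map_poly (\<lambda>p. coeff p a) G * map_poly (\<lambda>p. coeff p c) H"
  by (rule poly_eqI)
    (simp add: coeff_map_poly coeff_mult[of G] coeff_mult[of "map_poly _ _"] coeff_sum
      coeff_mult_degree_le assms)

text \<open>X-degrees add: the leading coefficients in X are nonzero polynomials in Y, and over a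
  domain their product is nonzero.\<close>

lemma inner_degree_mult:
  fixes G H :: "'a :: idom poly poly"
  assumes "\<And>j. degree (coeff G j) \<le> a" and "coeff (coeff G j) a \<noteq> 0"
    and "\<And>j. degree (coeff H j) \<le> c" and "coeff (coeff H k) c \<noteq> 0"
  shows "\<exists>l. coeff (coeff (G * H) l) (a + c) \<noteq> 0"
proof -
  have "coeff (map_poly (\<lambda>p. coeff p a) G) j \<noteq> 0" "coeff (map_poly (\<lambda>p. coeff p c) H) k \<noteq> 0"
    using assms(2,4) by (simp_all add: coeff_map_poly)
  then have "map_poly (\<lambda>p. coeff p a) G * map_poly (\<lambda>p. coeff p c) H \<noteq> 0"
    by auto
  then have "map_poly (\<lambda>p. coeff p (a + c)) (G * H) \<noteq> 0"
    by (simp add: map_poly_coeff_mult assms)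
  then show ?thesis
    by (auto simp: poly_eq_iff coeff_map_poly)
qed

lemma constant_polyI:
  assumes "\<And>j. degree (coeff G j) = 0" and "degree G = 0"
  shows "constant_poly G"
proof -
  obtain p where p: "G = [:p:]" using degree_eq_zeroE[OF assms(2)] .
  moreover have "degree p = 0" using assms(1)[of 0] p by simp
  ultimately show ?thesis unfolding constant_poly_def by (metis degree_eq_zeroE)
qed

text \<open>The pair is the exact bidegree of \<open>G\<close>. Additivity of both degrees puts
  \<open>H\<close> into the complementary box; \<open>(0, 0)\<close> would make \<open>G\<close>
  constant, and \<open>(n, n)\<close> would make \<open>H\<close> constant.\<close>

lemma reducible_box_factorable:
  assumes "\<epsilon> \<in> box_coeffs n n" and "reducible_poly (bivar_poly n \<epsilon>)"
  shows "\<exists>a\<le>n. \<exists>b\<le>n. (a, b) \<noteq> (0, 0) \<and> (a, b) \<noteq> (n, n) \<and> \<epsilon> \<in> box_factorable n a b"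
proof -
  obtain G H where G: "\<not> constant_poly G" and H: "\<not> constant_poly H"
      and F: "bivar_poly n \<epsilon> = G * H"
    using assms(2) unfolding reducible_poly_def by blast
  \<comment> \<open>The zero polynomial counts as constant.\<close>
  have "G \<noteq> 0" "H \<noteq> 0"
    using G H constant_polyI by force+
  obtain a j where a: "\<And>j. degree (coeff G j) \<le> a" "coeff (coeff G j) a \<noteq> 0"
    using ex_inner_degree[OF \<open>G \<noteq> 0\<close>] by blast
  obtain c k where c: "\<And>j. degree (coeff H j) \<le> c" "coeff (coeff H k) c \<noteq> 0"
    using ex_inner_degree[OF \<open>H \<noteq> 0\<close>] by blast
  obtain l where "coeff (coeff (bivar_poly n \<epsilon>) l) (a + c) \<noteq> 0"
    using inner_degree_mult[OF a c] F by auto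
  then have ac: "a + c \<le> n"
    by (auto simp: bivar_poly_eq_box_poly coeff_box_poly split: if_splits)
  have "degree (bivar_poly n \<epsilon>) \<le> n"
    by (rule degree_le) (auto simp: bivar_poly_eq_box_poly coeff_box_poly poly_eq_iff)
  then have deg: "degree G + degree H \<le> n"
    using F \<open>G \<noteq> 0\<close> \<open>H \<noteq> 0\<close> by (simp add: degree_mult_eq)
  have "(a, degree G) \<noteq> (0, 0)"
  proof
    assume "(a, degree G) = (0, 0)"
    then show False using G a(1) constant_polyI[of G] by auto
  qed
  moreover have "(a, degree G) \<noteq> (n, n)"
  proof
    assume "(a, degree G) = (n, n)"
    then have "c = 0" "degree H = 0" using ac deg by auto
    then show False using H c(1) constant_polyI[of H] by auto
  qed
  moreover have "degree (coeff H j) \<le> n - a" for j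
    using c(1)[of j] ac by linarith
  then have "\<epsilon> \<in> box_factorable n a (degree G)"
    using assms(1) F a(1) deg unfolding box_factorable_def
    by (intro CollectI conjI exI[of _ G] exI[of _ H]) auto
  moreover have "a \<le> n" "degree G \<le> n" using ac deg by auto
  ultimately show ?thesis by blast
qed

section \<open>The union bound over bidegrees\<close>

text \<open>With \<open>c = n - a\<close> and \<open>d = n - b\<close>, expanding
  \<open>(a + c) * (b + d)\<close> reduces the claim to
  \<open>n \<le> a * d + c * b\<close>.\<close>

lemma exponent_bound:
  fixes a b n :: nat
  assumes "a \<le> n" "b \<le> n" "(a, b) \<noteq> (0, 0)" "(a, b) \<noteq> (n, n)"
  shows "(a + 1) * (b + 1) + (n - a + 1) * (n - b + 1) + n \<le> (n + 1) * (n + 1) + 1"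
proof -
  obtain c d where n: "n = a + c" and d: "n = b + d"
    using assms(1,2) le_Suc_ex by metis
  have "n \<le> a * d + c * b"
  \<comment> \<open>If \<open>a = 0\<close>, then \<open>c = n\<close> and \<open>b > 0\<close>, so
    \<open>c * b\<close> suffices; if \<open>c = 0\<close>, then \<open>a = n\<close> and
    \<open>d > 0\<close>, so \<open>a * d\<close> does. Otherwise both \<open>a\<close> and
    \<open>c\<close> are positive, and the sum is at least \<open>d + b = n\<close>.\<close>
  proof (cases "a = 0 \<or> c = 0")
    case True
    then show ?thesis using assms n d by (cases "a = 0") auto
  next
    case False
    then have "d \<le> a * d" "b \<le> c * b" by auto
    then show ?thesis using d by linarith
  qed
  moreover have "n * n = (a + c) * (b + d)" using n d by simp
  ultimately have "a * b + c * d + n \<le> n * n"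
    by (simp add: algebra_simps)
  moreover have "n - a = c" "n - b = d" using n d by auto
  ultimately show ?thesis using n d by (simp add: algebra_simps)
qed

text \<open>The factor \<open>3 ^ n\<close> stands on the left so that the count stays within the
  natural numbers.\<close>

lemma card_reducible:
  "card {\<epsilon> \<in> box_coeffs n n. reducible_poly (bivar_poly n \<epsilon>)} * 3 ^ n
    \<le> (n + 1)\<^sup>2 * 3 * 3 ^ ((n + 1) * (n + 1))"
proof -
  let ?I = "{(a, b). a \<le> n \<and> b \<le> n \<and> (a, b) \<noteq> (0, 0) \<and> (a, b) \<noteq> (n, n)}"
  have I: "?I \<subseteq> {..n} \<times> {..n}" by auto
  then have finI: "finite ?I" by (rule finite_subset) simp
  have "card ?I \<le> card ({..n} \<times> {..n})"
    using I by (intro card_mono) auto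
  then have cardI: "card ?I \<le> (n + 1)\<^sup>2"
    by (simp add: card_cartesian_product power2_eq_square)
  have "{\<epsilon> \<in> box_coeffs n n. reducible_poly (bivar_poly n \<epsilon>)}
      \<subseteq> (\<Union>(a, b)\<in>?I. box_factorable n a b)"
    using reducible_box_factorable by fastforce
  moreover have "finite (box_factorable n a b)" for a b
    by (rule finite_subset[OF _ finite_box_coeffs[of n n]]) (auto simp: box_factorable_def)
  ultimately have "card {\<epsilon> \<in> box_coeffs n n. reducible_poly (bivar_poly n \<epsilon>)}
      \<le> card (\<Union>(a, b)\<in>?I. box_factorable n a b)"
    using finI by (intro card_mono finite_UN_I) auto
  also have "\<dots> \<le> (\<Sum>(a, b)\<in>?I. card (box_factorable n a b))"
    using card_UN_le[OF finI, of "\<lambda>(a, b). box_factorable n a b"] by (simp add: case_prod_unfold)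
  finally have "card {\<epsilon> \<in> box_coeffs n n. reducible_poly (bivar_poly n \<epsilon>)} * 3 ^ n
      \<le> (\<Sum>(a, b)\<in>?I. card (box_factorable n a b)) * 3 ^ n"
    by (rule mult_le_mono1)
  also have "\<dots> = (\<Sum>(a, b)\<in>?I. card (box_factorable n a b) * 3 ^ n)"
    by (simp add: sum_distrib_right case_prod_unfold)
  also have "\<dots> \<le> (\<Sum>(a, b)\<in>?I. 3 ^ ((n + 1) * (n + 1) + 1))"
  proof (intro sum_mono)
    fix x assume "x \<in> ?I"
    then obtain a b where x: "x = (a, b)"
        and ab: "a \<le> n" "b \<le> n" "(a, b) \<noteq> (0, 0)" "(a, b) \<noteq> (n, n)"
      by auto
    have "card (box_factorable n a b) * 3 ^ n
        \<le> 3 ^ ((a + 1) * (b + 1) + (n - a + 1) * (n - b + 1)) * 3 ^ n"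
      using card_box_factorable by (rule mult_le_mono1)
    also have "\<dots> = 3 ^ ((a + 1) * (b + 1) + (n - a + 1) * (n - b + 1) + n)"
      by (simp only: power_add)
    also have "\<dots> \<le> 3 ^ ((n + 1) * (n + 1) + 1)"
      using exponent_bound[OF ab] by (rule power_increasing) simp
    finally show "(case x of (a, b) \<Rightarrow> card (box_factorable n a b) * 3 ^ n)
        \<le> (case x of (a, b) \<Rightarrow> 3 ^ ((n + 1) * (n + 1) + 1))"
      by (simp only: x prod.case)
  qed
  also have "\<dots> = card ?I * 3 ^ ((n + 1) * (n + 1) + 1)"
    by (simp add: case_prod_unfold)
  also have "\<dots> \<le> (n + 1)\<^sup>2 * 3 ^ ((n + 1) * (n + 1) + 1)"
    using cardI by (rule mult_le_mono1)
  finally show ?thesis by (simp add: mult.assoc)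
qed

section \<open>From counting to the limit of probabilities\<close>

text \<open>Independent uniform coordinates are jointly uniform on the finite box, which turns the
  probability into a quotient of cardinalities.\<close>

lemma random_coeffs_eq: "random_coeffs n = pmf_of_set (box_coeffs n n)"
  unfolding random_coeffs_def box_coeffs_def by (rule Pi_pmf_of_set) auto

lemma prob_reducible_le:
  "measure_pmf.prob (random_poly n) {F. reducible_poly F} \<le> (real n + 1)\<^sup>2 * 3 / 3 ^ n"
proof -
  let ?N = "3 ^ ((n + 1) * (n + 1)) :: nat"
  let ?R = "{\<epsilon> \<in> box_coeffs n n. reducible_poly (bivar_poly n \<epsilon>)}"
  have "box_coeffs n n \<noteq> {}"
    using card_box_coeffs[of n n] by auto
  then have "measure_pmf.prob (random_poly n) {F. reducible_poly F}
      = real (card (box_coeffs n n \<inter> bivar_poly n -` {F. reducible_poly F}))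
        / real (card (box_coeffs n n))"
    unfolding random_poly_def random_coeffs_eq
    by (simp add: measure_pmf_of_set finite_box_coeffs)
  also have "box_coeffs n n \<inter> bivar_poly n -` {F. reducible_poly F} = ?R"
    by auto
  also have "card (box_coeffs n n) = ?N"
    by (rule card_box_coeffs)
  also have "real (card ?R) / real ?N \<le> (real n + 1)\<^sup>2 * 3 / 3 ^ n"
  proof -
    have "real (card ?R * 3 ^ n) \<le> real ((n + 1)\<^sup>2 * 3 * ?N)"
      using card_reducible by (rule of_nat_mono)
    then have "real (card ?R) * 3 ^ n \<le> (real n + 1)\<^sup>2 * 3 * real ?N"
      by (simp only: of_nat_mult of_nat_power of_nat_add of_nat_1 of_nat_numeral)
    moreover have "real ?N > 0" by simp
    ultimately show ?thesis
      by (simp only: pos_divide_le_eq times_divide_eq_left pos_le_divide_eq zero_less_power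
          zero_less_numeral)
  qed
  finally show ?thesis .
qed

theorem theorem3p1:
  "(\<lambda>n. measure_pmf.prob (random_poly n) {F. reducible_poly F}) \<longlonglongrightarrow> 0"
proof (rule tendsto_sandwich[OF _ _ tendsto_const])
  show "(\<lambda>n. (real n + 1)\<^sup>2 * 3 / 3 ^ n) \<longlonglongrightarrow> 0"
    by real_asymp
qed (simp_all add: prob_reducible_le)

end
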